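(* For every hypergraph $H$, $$\mathbf{w}_{\mathbf{Hyp}}(H)=\mathbf{tw}(\mathrm{Gaif}(H))=\mathbf{tw}_{\mathbf{Hyp}}(H).$$
   Context: Hypergraphs: a hypergraph $H$ is a finite set $V(H)$ of vertices with a set $E(H)$ of nonempty subsets of $V(H)$ (hyperedges); $E_n(H)$ is the set of hyperedges of cardinality $n$. A hypergraph homomorphism $f:H\to H'$ is a function $f:V(H)\to V(H')$ such that $e\in E_n(H)$ implies $f(e)\in E_n(H')$ for every $n$. $\mathbf{Hyp}$ is the resulting category. $K^n_{\mathbf{Hyp}}$ is the hypergraph with vertex set $\{1,\dots,n\}$ in which every nonempty subset is a hyperedge. The Gaifman graph $\mathrm{Gaif}(H)$ is the simple graph with vertex set $V(H)$ in which $xy$ is an edge iff $x\ne y$ and some hyperedge of $H$ contains both $x$ and $y$. $\mathbf{w}_{\mathbf{Hyp}}(H)$: a tree is a nonempty (finite) connected graph with no cycles. For a tree $T$, the category $\int T$ has as objects the vertices and the (unordered) edges of $T$, with only non-identity morphisms $e_x:e\to x$ and $e_y:e\to y$ for each edge $e=xy$. A tree-shaped structured decomposition of $H$ is a functor $d:\int T\to\mathbf{Hyp}$, $T$ a tree, sending every morphism to a monomorphism, with $\operatorname{colim} d\cong H$. The size $s(X)$ of a hypergraph $X$ is the smallest $n$ such that there is a monomorphism $X\hookrightarrow K^m_{\mathbf{Hyp}}$ with $m\le n$. The width of $d$ is $\max_{t\in V(T)}s(d(t))-1$, and $\mathbf{w}_{\mathbf{Hyp}}(H)$ is the minimum width of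 all tree-shaped structured decompositions of $H$. $\mathbf{tw}_{\mathbf{Hyp}}(H)$: an RS-tree decomposition of $H$ is a tree $T$ with a function $X:V(T)\to P(V(H))$ such that (1) $\bigcup_t X(t)=V(H)$; (2) for every $e\in E(H)$ there is $t$ with $e\subseteq X(t)$; (3) if $t_2$ lies on the unique path between $t_1$ and $t_3$ then $X(t_1)\cap X(t_3)\subseteq X(t_2)$. Its width is $\max_t|X(t)|-1$, and $\mathbf{tw}_{\mathbf{Hyp}}(H)$ is the minimum width. $\mathbf{tw}(G)$ is the usual treewidth of a simple graph $G$, defined by the same conditions with the edges of $G$ (as 2-element sets) in place of hyperedges. *)

theory Defs
  imports Main "HOL-Library.FuncSet"
begin

subsection \<open>Graphs, trees and tree decompositions\<close>

record 'a pre_graph =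
  gverts :: "'a set"
  gedges :: "'a set set"

definition simple_graph :: "'a pre_graph \<Rightarrow> bool" where
  "simple_graph G \<longleftrightarrow>
     finite (gverts G) \<and> (\<forall>e\<in>gedges G. e \<subseteq> gverts G \<and> card e = 2)"

definition walk :: "'a pre_graph \<Rightarrow> 'a list \<Rightarrow> bool" where
  "walk G p \<longleftrightarrow>
     p \<noteq> [] \<and> set p \<subseteq> gverts G \<and> (\<forall>i. Suc i < length p \<longrightarrow> {p ! i, p ! Suc i} \<in> gedges G)"

definition path_between :: "'a pre_graph \<Rightarrow> 'a \<Rightarrow> 'a list \<Rightarrow> 'a \<Rightarrow> bool" where
  "path_between G x p y \<longleftrightarrow> walk G p \<and> distinct p \<and> hd p = x \<and> last p = y"

text \<open>A cycle is given by the list of its vertices, without repeating the first one at the end.\<close>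

definition cycle :: "'a pre_graph \<Rightarrow> 'a list \<Rightarrow> bool" where
  "cycle G p \<longleftrightarrow>
     walk G p \<and> distinct p \<and> 3 \<le> length p \<and> {last p, hd p} \<in> gedges G"

definition tree :: "'a pre_graph \<Rightarrow> bool" where
  "tree T \<longleftrightarrow>
     simple_graph T \<and> gverts T \<noteq> {} \<and>
     (\<forall>x\<in>gverts T. \<forall>y\<in>gverts T. \<exists>p. path_between T x p y) \<and>
     (\<nexists>p. cycle T p)"

text \<open>Tree decompositions of a vertex set \<open>V\<close> with a family \<open>E\<close> of subsets of \<open>V\<close>; this covers
  both simple graphs and hypergraphs. Paths in a tree are unique, so the last condition may
  quantify over all of them.\<close>

definition tree_decomposition ::
    "'a set \<Rightarrow> 'a set set \<Rightarrow> 't pre_graph \<Rightarrow> ('t \<Rightarrow> 'a set) \<Rightarrow> bool" where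
  "tree_decomposition V E T X \<longleftrightarrow>
     tree T \<and>
     X \<in> gverts T \<rightarrow> Pow V \<and>
     (\<Union>t\<in>gverts T. X t) = V \<and>
     (\<forall>e\<in>E. \<exists>t\<in>gverts T. e \<subseteq> X t) \<and>
     (\<forall>t1 t2 t3 p. path_between T t1 p t3 \<and> t2 \<in> set p \<longrightarrow> X t1 \<inter> X t3 \<subseteq> X t2)"

definition td_width :: "'t pre_graph \<Rightarrow> ('t \<Rightarrow> 'a set) \<Rightarrow> int" where
  "td_width T X = Max ((\<lambda>t. int (card (X t))) ` gverts T) - 1"

text \<open>Widths are integers, since the empty (hyper)graph has width \<open>-1\<close>. Trees are finite, so it
  is no restriction to take their vertices in \<^typ>\<open>nat\<close>.\<close>

definition tw :: "'a pre_graph \<Rightarrow> int" where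
  "tw G = (LEAST k. \<exists>(T :: nat pre_graph) X.
      tree_decomposition (gverts G) (gedges G) T X \<and> td_width T X = k)"


subsection \<open>The category of hypergraphs\<close>

record 'a pre_hypergraph =
  hverts :: "'a set"
  hedges :: "'a set set"

definition hypergraph :: "'a pre_hypergraph \<Rightarrow> bool" where
  "hypergraph H \<longleftrightarrow>
     finite (hverts H) \<and> (\<forall>e\<in>hedges H. e \<noteq> {} \<and> e \<subseteq> hverts H)"

definition hedges_card :: "nat \<Rightarrow> 'a pre_hypergraph \<Rightarrow> 'a set set" where
  "hedges_card n H = {e \<in> hedges H. card e = n}"

text \<open>Homomorphisms are extensional functions, so that two parallel morphisms are equal iff they
  are equal in HOL; the composite of \<open>f : X \<rightarrow> Y\<close> and \<open>g : Y \<rightarrow> Z\<close> is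
  \<open>compose (hverts X) g f\<close>.\<close>

definition hyp_hom :: "'a pre_hypergraph \<Rightarrow> 'b pre_hypergraph \<Rightarrow> ('a \<Rightarrow> 'b) set" where
  "hyp_hom H H' =
     {f \<in> hverts H \<rightarrow>\<^sub>E hverts H'. \<forall>n. \<forall>e\<in>hedges_card n H. f ` e \<in> hedges_card n H'}"

definition hyp_id :: "'a pre_hypergraph \<Rightarrow> 'a \<Rightarrow> 'a" where
  "hyp_id H = (\<lambda>x\<in>hverts H. x)"

definition hyp_iso :: "'a pre_hypergraph \<Rightarrow> 'b pre_hypergraph \<Rightarrow> bool" where
  "hyp_iso H H' \<longleftrightarrow>
     (\<exists>f\<in>hyp_hom H H'. \<exists>g\<in>hyp_hom H' H.
        compose (hverts H) g f = hyp_id H \<and> compose (hverts H') f g = hyp_id H')"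

text \<open>Every hypergraph is finite, hence isomorphic to one with vertices in \<^typ>\<open>nat\<close>. Test objects
  in universal properties, and the values of diagrams, are therefore taken over \<^typ>\<open>nat\<close>.\<close>

definition hyp_mono :: "nat pre_hypergraph \<Rightarrow> nat pre_hypergraph \<Rightarrow> (nat \<Rightarrow> nat) \<Rightarrow> bool" where
  "hyp_mono X Y f \<longleftrightarrow>
     f \<in> hyp_hom X Y \<and>
     (\<forall>(Z :: nat pre_hypergraph) g h.
        hypergraph Z \<and> g \<in> hyp_hom Z X \<and> h \<in> hyp_hom Z X \<and>
        compose (hverts Z) f g = compose (hverts Z) f h \<longrightarrow> g = h)"

definition hyp_complete :: "nat \<Rightarrow> nat pre_hypergraph" where
  "hyp_complete n = \<lparr>hverts = {1..n}, hedges = {e. e \<subseteq> {1..n} \<and> e \<noteq> {}}\<rparr>"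

definition hyp_size :: "nat pre_hypergraph \<Rightarrow> nat" where
  "hyp_size X = (LEAST n. \<exists>m\<le>n. \<exists>f. hyp_mono X (hyp_complete m) f)"


subsection \<open>Structured decompositions\<close>

text \<open>The category \<open>\<integral>T\<close>. There is at most one morphism between any two objects, so a morphism is
  determined by its domain and codomain.\<close>

datatype 't int_object = Vertex 't | Edge "'t set"

definition int_objects :: "'t pre_graph \<Rightarrow> 't int_object set" where
  "int_objects T = Vertex ` gverts T \<union> Edge ` gedges T"

definition int_arrow :: "'t pre_graph \<Rightarrow> 't int_object \<Rightarrow> 't int_object \<Rightarrow> bool" where
  "int_arrow T i j \<longleftrightarrow>
     (i \<in> int_objects T \<and> i = j) \<or>
     (\<exists>e\<in>gedges T. \<exists>x\<in>e. i = Edge e \<and> j = Vertex x)"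

text \<open>Functors from \<open>\<integral>T\<close> to hypergraphs: \<open>D\<close> is the action on objects, and \<open>M i j\<close> is the image
  of the morphism from \<open>i\<close> to \<open>j\<close>.\<close>

definition hyp_functor ::
    "'t pre_graph \<Rightarrow> ('t int_object \<Rightarrow> nat pre_hypergraph) \<Rightarrow>
     ('t int_object \<Rightarrow> 't int_object \<Rightarrow> nat \<Rightarrow> nat) \<Rightarrow> bool" where
  "hyp_functor T D M \<longleftrightarrow>
     (\<forall>i\<in>int_objects T. hypergraph (D i)) \<and>
     (\<forall>i j. int_arrow T i j \<longrightarrow> M i j \<in> hyp_hom (D i) (D j)) \<and>
     (\<forall>i\<in>int_objects T. M i i = hyp_id (D i)) \<and>
     (\<forall>i j k. int_arrow T i j \<and> int_arrow T j k \<longrightarrow>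
        M i k = compose (hverts (D i)) (M j k) (M i j))"

definition cocone ::
    "'t pre_graph \<Rightarrow> ('t int_object \<Rightarrow> nat pre_hypergraph) \<Rightarrow>
     ('t int_object \<Rightarrow> 't int_object \<Rightarrow> nat \<Rightarrow> nat) \<Rightarrow>
     nat pre_hypergraph \<Rightarrow> ('t int_object \<Rightarrow> nat \<Rightarrow> nat) \<Rightarrow> bool" where
  "cocone T D M L c \<longleftrightarrow>
     hypergraph L \<and>
     (\<forall>i\<in>int_objects T. c i \<in> hyp_hom (D i) L) \<and>
     (\<forall>i j. int_arrow T i j \<longrightarrow> compose (hverts (D i)) (c j) (M i j) = c i)"

definition colimit ::
    "'t pre_graph \<Rightarrow> ('t int_object \<Rightarrow> nat pre_hypergraph) \<Rightarrow>
     ('t int_object \<Rightarrow> 't int_object \<Rightarrow> nat \<Rightarrow> nat) \<Rightarrow>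
     nat pre_hypergraph \<Rightarrow> ('t int_object \<Rightarrow> nat \<Rightarrow> nat) \<Rightarrow> bool" where
  "colimit T D M L c \<longleftrightarrow>
     cocone T D M L c \<and>
     (\<forall>L' c'. cocone T D M L' c' \<longrightarrow>
        (\<exists>!u. u \<in> hyp_hom L L' \<and>
           (\<forall>i\<in>int_objects T. compose (hverts (D i)) u (c i) = c' i)))"

definition structured_decomposition ::
    "'a pre_hypergraph \<Rightarrow> 't pre_graph \<Rightarrow> ('t int_object \<Rightarrow> nat pre_hypergraph) \<Rightarrow>
     ('t int_object \<Rightarrow> 't int_object \<Rightarrow> nat \<Rightarrow> nat) \<Rightarrow> bool" where
  "structured_decomposition H T D M \<longleftrightarrow>
     tree T \<and> hyp_functor T D M \<and>
     (\<forall>i j. int_arrow T i j \<longrightarrow> hyp_mono (D i) (D j) (M i j)) \<and>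
     (\<exists>L c. colimit T D M L c \<and> hyp_iso L H)"

definition sd_width :: "'t pre_graph \<Rightarrow> ('t int_object \<Rightarrow> nat pre_hypergraph) \<Rightarrow> int" where
  "sd_width T D = Max ((\<lambda>t. int (hyp_size (D (Vertex t)))) ` gverts T) - 1"


subsection \<open>The width parameters of hypergraphs\<close>

definition w_Hyp :: "'a pre_hypergraph \<Rightarrow> int" where
  "w_Hyp H = (LEAST k. \<exists>(T :: nat pre_graph) D M.
      structured_decomposition H T D M \<and> sd_width T D = k)"

definition tw_Hyp :: "'a pre_hypergraph \<Rightarrow> int" where
  "tw_Hyp H = (LEAST k. \<exists>(T :: nat pre_graph) X.
      tree_decomposition (hverts H) (hedges H) T X \<and> td_width T X = k)"

definition Gaif :: "'a pre_hypergraph \<Rightarrow> 'a pre_graph" where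
  "Gaif H = \<lparr>gverts = hverts H,
     gedges = {{x, y} |x y. x \<in> hverts H \<and> y \<in> hverts H \<and> x \<noteq> y \<and>
                            (\<exists>e\<in>hedges H. x \<in> e \<and> y \<in> e)}\<rparr>"

end

theory Submission imports Defs
begin

text \<open>Subtrees of a tree have the Helly property, so every clique of the Gaifman graph, in
  particular every hyperedge, lies in a single bag: \<open>H\<close> and its Gaifman graph have the same tree
  decompositions. A monomorphism of hypergraphs is an injective homomorphism, so the size of a
  hypergraph is its number of vertices. The bags of a tree decomposition and their intersections
  along the edges of the tree induce subhypergraphs whose colimit is \<open>H\<close>. Conversely, the images
  in \<open>H\<close> of the values of a structured decomposition are the bags of a tree decomposition, at most
  as wide; both coverage and the path condition come from the universal property.\<close>

section \<open>Walks and trees\<close>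

lemma walk_not_Nil [simp]: "\<not> walk G []"
  by (simp add: walk_def)

text \<open>Trades the index condition in \<open>walk\<close> for a recursion on the list, so that
  facts about walks can be proved by list induction.\<close>

lemma walk_Cons:
  "walk G (x # p) \<longleftrightarrow> x \<in> gverts G \<and> (p = [] \<or> ({x, hd p} \<in> gedges G \<and> walk G p))"
proof (cases p)
  case Nil
  then show ?thesis by (simp add: walk_def)
next
  case (Cons y q)
  have split: "(\<forall>i. Q i) \<longleftrightarrow> Q 0 \<and> (\<forall>i. Q (Suc i))" for Q
    by (metis not0_implies_Suc)
  have "(\<forall>i. Suc i < length (x # p) \<longrightarrow> {(x # p) ! i, (x # p) ! Suc i} \<in> gedges G) \<longleftrightarrow>
        {x, y} \<in> gedges G \<and> (\<forall>i. Suc i < length p \<longrightarrow> {p ! i, p ! Suc i} \<in> gedges G)"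
    using Cons by (subst split) simp
  then show ?thesis using Cons by (auto simp: walk_def)
qed

lemma walk_append:
  assumes "p \<noteq> []" "q \<noteq> []"
  shows "walk G (p @ q) \<longleftrightarrow> walk G p \<and> walk G q \<and> {last p, hd q} \<in> gedges G"
  using assms
proof (induction p)
  case (Cons x p)
  then show ?case by (cases "p = []") (auto simp: walk_Cons)
qed simp

lemma walk_rev: "walk G (rev p) \<longleftrightarrow> walk G p"
proof (induction p)
  case (Cons x p)
  then show ?case
    by (cases "p = []") (auto simp: walk_Cons walk_append last_rev insert_commute)
qed simp

lemma walk_join:
  assumes "walk G p" "walk G q" "last p = hd q"
  shows "walk G (p @ tl q)" "hd (p @ tl q) = hd p" "last (p @ tl q) = last q"
    "set (p @ tl q) = set p \<union> set q"
proof -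
  have "p \<noteq> []" "q \<noteq> []" using assms by auto
  then obtain x r where q: "q = x # r" by (cases q) auto
  have "x \<in> set p" using assms(3) q \<open>p \<noteq> []\<close> by (metis last_in_set list.sel(1))
  then show "walk G (p @ tl q)" "hd (p @ tl q) = hd p" "last (p @ tl q) = last q"
    "set (p @ tl q) = set p \<union> set q"
    using assms q \<open>p \<noteq> []\<close> by (cases "r = []"; auto simp: walk_append walk_Cons)+
qed

text \<open>Loop erasure from the front: if the first vertex reappears in the shortened tail,
  everything before that reappearance is dropped.\<close>

lemma walk_imp_distinct_walk:
  assumes "walk G p"
  shows "\<exists>q. walk G q \<and> distinct q \<and> hd q = hd p \<and> last q = last p \<and> set q \<subseteq> set p"
  using assms
proof (induction p)
  case (Cons x p)
  show ?case
  proof (cases "p = []")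
    case True
    then show ?thesis using Cons.prems by (intro exI[of _ "[x]"]) auto
  next
    case False
    then obtain q where q: "walk G q" "distinct q" "hd q = hd p" "last q = last p" "set q \<subseteq> set p"
      using Cons by (auto simp: walk_Cons)
    have "q \<noteq> []" using q by auto
    show ?thesis
    proof (cases "x \<in> set q")
      case True
      then obtain r s where rs: "q = r @ x # s" by (auto dest: split_list)
      have "walk G (x # s)" using q(1) rs by (cases "r = []") (auto simp: walk_append)
      then show ?thesis
        using q rs False by (intro exI[of _ "x # s"]) auto
    next
      case notin: False
      show ?thesis
        using q notin False \<open>q \<noteq> []\<close> Cons.prems
        by (intro exI[of _ "x # q"]) (auto simp: walk_Cons)
    qed
  qed
qed simp

text \<open>If \<open>q\<close> avoided \<open>t2\<close>, the neighbours of \<open>t2\<close> on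
  \<open>p\<close> would be joined by a detour through \<open>q\<close> that avoids
  \<open>t2\<close>, and adding \<open>t2\<close> to it would close a cycle. Since \<open>q\<close>
  may be any walk, this describes the components left after deleting \<open>t2\<close>.\<close>

lemma tree_path_separates:
  assumes "tree T" "path_between T t1 p t3" "t2 \<in> set p"
    and "walk T q" "hd q = t1" "last q = t3"
  shows "t2 \<in> set q"
proof (rule ccontr)
  assume t2: "t2 \<notin> set q"
  have q: "q \<noteq> []" using assms by auto
  have p: "walk T p" "distinct p" "hd p = t1" "last p = t3"
    using assms(2) by (auto simp: path_between_def)
  obtain p1 p2 where p12: "p = p1 @ t2 # p2" using assms(3) by (auto dest: split_list)
  \<comment> \<open>The endpoints of \<open>p\<close> lie on \<open>q\<close>, so \<open>t2\<close>
    is neither of them and has a neighbour on each side.\<close>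
  have ne: "p1 \<noteq> []" "p2 \<noteq> []"
    using p(3,4) p12 assms(5,6) t2 q by (metis append_Nil hd_in_set list.sel(1))
      (metis last_snoc assms(6) last_in_set p(4) p12 q t2)
  have w: "walk T p1" "walk T p2" "{last p1, t2} \<in> gedges T" "{t2, hd p2} \<in> gedges T" "t2 \<in> gverts T"
    using p(1) p12 ne by (auto simp: walk_append walk_Cons)
  \<comment> \<open>The detour: back along \<open>p1\<close> to \<open>t1\<close>, then along
    \<open>q\<close> to \<open>t3\<close>; below, \<open>s\<close> continues back along
    \<open>p2\<close> to the other neighbour of \<open>t2\<close>.\<close>
  define r where "r = rev p1 @ tl q"
  have r: "walk T r" "hd r = last p1" "last r = t3" "set r = set p1 \<union> set q"
    using walk_join[of T "rev p1" q] w ne p p12 assms(4-6)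
    by (auto simp: r_def walk_rev last_rev hd_rev)
  define s where "s = r @ tl (rev p2)"
  have s: "walk T s" "hd s = last p1" "last s = hd p2" "set s = set p1 \<union> set q \<union> set p2"
    using walk_join[of T r "rev p2"] r w ne p p12
    by (auto simp: s_def walk_rev last_rev hd_rev)
  obtain c where c: "walk T c" "distinct c" "hd c = last p1" "last c = hd p2" "set c \<subseteq> set s"
    using walk_imp_distinct_walk[OF s(1)] s by auto
  have cne: "c \<noteq> []" using c by auto
  \<comment> \<open>The two neighbours differ, so \<open>c\<close> has at least two vertices and
    \<open>t2 # c\<close> reaches the length 3 required of a cycle.\<close>
  have "last p1 \<noteq> hd p2" using p(2) p12 ne by (metis Un_iff disjoint_iff distinct_append
        last_in_set hd_in_set list.set_intros(2))
  then have "2 \<le> length c"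
    using c cne by (cases c; cases "tl c") auto
  moreover have "t2 \<notin> set c" using c s t2 p p12 by auto
  ultimately have "cycle T (t2 # c)"
    using c w cne by (auto simp: cycle_def walk_Cons insert_commute)
  then show False using assms(1) by (auto simp: tree_def)
qed

lemma tree_path_exists:
  assumes "tree T" "x \<in> gverts T" "y \<in> gverts T"
  obtains p where "path_between T x p y"
proof -
  have "\<exists>p. path_between T x p y"
    using assms unfolding tree_def by simp
  then show ?thesis using that by blast
qed

lemma tree_edgeD:
  assumes "tree T" "e \<in> gedges T"
  shows "e \<subseteq> gverts T" "\<exists>x y. e = {x, y}"
proof -
  have "e \<subseteq> gverts T \<and> card e = 2"
    using assms unfolding tree_def simple_graph_def by simp
  then show "e \<subseteq> gverts T" "\<exists>x y. e = {x, y}"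
    by (auto simp: card_2_iff)
qed

section \<open>The Helly property of subtrees\<close>

text \<open>Stands for the vertex set of a subtree, possibly empty. Points outside
  \<open>gverts T\<close> are harmless because no path visits them; hence the explicit intersections
  with \<open>gverts T\<close> in the Helly statements.\<close>

definition path_convex :: "'t pre_graph \<Rightarrow> 't set \<Rightarrow> bool" where
  "path_convex T A \<longleftrightarrow>
     (\<forall>x y p. path_between T x p y \<and> x \<in> A \<and> y \<in> A \<longrightarrow> set p \<subseteq> A)"

lemma path_convex_Int: "path_convex T A \<Longrightarrow> path_convex T B \<Longrightarrow> path_convex T (A \<inter> B)"
  by (fastforce simp: path_convex_def)

lemma tree_median:
  assumes T: "tree T" and "a \<in> gverts T" "b \<in> gverts T" "c \<in> gverts T"
  obtains m p q r where "path_between T a p b" "path_between T c q a" "path_between T c r b"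
    "m \<in> set p" "m \<in> set q" "m \<in> set r"
proof -
  obtain p where p: "path_between T a p b" using tree_path_exists assms by metis
  obtain q where q: "path_between T c q a" using tree_path_exists assms by metis
  have "a \<in> set q" "a \<in> set p" using p q
    by (metis last_in_set path_between_def walk_not_Nil, metis hd_in_set path_between_def walk_not_Nil)
  then have "\<exists>x\<in>set q. x \<in> set p" by blast
  \<comment> \<open>The median is the first vertex of the path \<open>q\<close> that lies on \<open>p\<close>.\<close>
  then obtain q1 m q2 where m: "q = q1 @ m # q2" "m \<in> set p" "\<forall>y\<in>set q1. y \<notin> set p"
    using split_list_first_prop[of q "\<lambda>x. x \<in> set p"] by blast
  obtain p1 p2 where p12: "p = p1 @ m # p2" using m(2) by (auto dest: split_list)
  \<comment> \<open>Follow \<open>q\<close> as far as \<open>m\<close>, then \<open>p\<close>; no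
    vertex repeats because \<open>q1\<close> avoids \<open>p\<close>.\<close>
  define r where "r = q1 @ m # p2"
  have "walk T (m # p2)" using p p12
    by (cases "p1 = []") (auto simp: path_between_def walk_append)
  then have "walk T r" using q m unfolding r_def
    by (cases "q1 = []") (auto simp: path_between_def walk_append)
  moreover have "hd r = c" using q m unfolding r_def by (cases q1) (auto simp: path_between_def)
  moreover have "last r = b" using p p12 unfolding r_def by (auto simp: path_between_def)
  moreover have "distinct r" using p q m p12 unfolding r_def by (auto simp: path_between_def)
  ultimately have "path_between T c r b" by (simp add: path_between_def)
  then show ?thesis using that p q m r_def by (metis in_set_conv_decomp)
qed

text \<open>Choose a point in each pairwise intersection. Any two of the three points share one of
  the sets, which then contains the path between them; the median lies on all three paths.\<close>

lemma Helly_three: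
  assumes "tree T" and "path_convex T A" "path_convex T B" "path_convex T C"
    and "A \<inter> B \<inter> gverts T \<noteq> {}" "A \<inter> C \<inter> gverts T \<noteq> {}" "B \<inter> C \<inter> gverts T \<noteq> {}"
  shows "A \<inter> B \<inter> C \<inter> gverts T \<noteq> {}"
proof -
  obtain a b c where abc: "a \<in> B \<inter> C" "b \<in> A \<inter> C" "c \<in> A \<inter> B"
    "a \<in> gverts T" "b \<in> gverts T" "c \<in> gverts T"
    using assms by blast
  then obtain m p q r where
    "path_between T a p b" "path_between T c q a" "path_between T c r b"
    "m \<in> set p" "m \<in> set q" "m \<in> set r"
    using tree_median[OF assms(1)] by metis
  moreover from this have "m \<in> gverts T" by (auto simp: path_between_def walk_def)
  ultimately have "m \<in> A" "m \<in> B" "m \<in> C" "m \<in> gverts T"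
    using abc assms(2-4) unfolding path_convex_def by (metis IntE subsetD)+
  then show ?thesis by blast
qed

text \<open>Induction on the number of sets: intersect all remaining sets with \<open>A i\<close>.
  They stay convex, and they still meet pairwise by the case of three sets.\<close>

lemma Helly_tree:
  assumes T: "tree T" and "finite I" "I \<noteq> {}"
    and "\<And>i. i \<in> I \<Longrightarrow> path_convex T (A i)"
    and "\<And>i j. i \<in> I \<Longrightarrow> j \<in> I \<Longrightarrow> A i \<inter> A j \<inter> gverts T \<noteq> {}"
  shows "\<exists>t\<in>gverts T. \<forall>i\<in>I. t \<in> A i"
  using assms(2-)
proof (induction I arbitrary: A rule: finite_ne_induct)
  case (singleton i)
  then show ?case by blast
next
  case (insert i I)
  have "\<exists>t\<in>gverts T. \<forall>j\<in>I. t \<in> A i \<inter> A j"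
  proof (rule insert.IH)
    fix j assume "j \<in> I"
    then show "path_convex T (A i \<inter> A j)"
      using insert.prems by (intro path_convex_Int) auto
  next
    fix j k assume "j \<in> I" "k \<in> I"
    then have "A i \<inter> A j \<inter> A k \<inter> gverts T \<noteq> {}"
      using insert.prems by (intro Helly_three[OF T]) auto
    then show "A i \<inter> A j \<inter> (A i \<inter> A k) \<inter> gverts T \<noteq> {}" by blast
  qed
  then show ?case using insert.hyps by blast
qed

section \<open>Cliques in bags, and the Gaifman graph\<close>

lemma tree_decomposition_path_convex:
  assumes "tree_decomposition V E T X"
  shows "path_convex T {t. v \<in> X t}"
  using assms unfolding tree_decomposition_def path_convex_def by blast

text \<open>Helly applied to the subtrees \<open>{t. v \<in> X t}\<close> for \<open>v\<close> in
  \<open>C\<close>: a common tree vertex is a bag containing all of \<open>C\<close>.\<close>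

lemma tree_decomposition_clique:
  assumes td: "tree_decomposition V E T X" and "finite C" "C \<noteq> {}"
    and "\<And>x y. x \<in> C \<Longrightarrow> y \<in> C \<Longrightarrow> \<exists>t\<in>gverts T. x \<in> X t \<and> y \<in> X t"
  shows "\<exists>t\<in>gverts T. C \<subseteq> X t"
proof -
  have "tree T" using td by (simp add: tree_decomposition_def)
  then have "\<exists>t\<in>gverts T. \<forall>v\<in>C. t \<in> {t. v \<in> X t}"
  proof (rule Helly_tree)
    fix x y assume "x \<in> C" "y \<in> C"
    then show "{t. x \<in> X t} \<inter> {t. y \<in> X t} \<inter> gverts T \<noteq> {}" using assms(4) by fastforce
  qed (use assms(2,3) tree_decomposition_path_convex[OF td] in auto)
  then show ?thesis by auto
qed

lemma tree_decomposition_Gaif: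
  assumes H: "hypergraph H"
  shows "tree_decomposition (gverts (Gaif H)) (gedges (Gaif H)) T X \<longleftrightarrow>
         tree_decomposition (hverts H) (hedges H) T X" (is "?G \<longleftrightarrow> ?H")
proof
  assume G: ?G
  have "\<exists>t\<in>gverts T. e \<subseteq> X t" if e: "e \<in> hedges H" for e
  proof (rule tree_decomposition_clique[OF G])
    show "finite e" "e \<noteq> {}" using e H by (auto simp: hypergraph_def intro: finite_subset)
    fix x y assume xy: "x \<in> e" "y \<in> e"
    have V: "x \<in> hverts H" "y \<in> hverts H" using xy e H by (auto simp: hypergraph_def)
    show "\<exists>t\<in>gverts T. x \<in> X t \<and> y \<in> X t"
    \<comment> \<open>The Gaifman graph has no loops, so the diagonal case relies on the bags
      covering all vertices.\<close>
    proof (cases "x = y")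
      case True
      then show ?thesis using G V by (auto simp: tree_decomposition_def Gaif_def)
    next
      case False
      then have "{x, y} \<in> gedges (Gaif H)" using V xy e by (auto simp: Gaif_def)
      then show ?thesis using G by (fastforce simp: tree_decomposition_def)
    qed
  qed
  then show ?H using G by (auto simp: tree_decomposition_def Gaif_def)
next
  assume h: ?H
  have "\<exists>t\<in>gverts T. e \<subseteq> X t" if e: "e \<in> gedges (Gaif H)" for e
  proof -
    obtain x y e' where "e = {x, y}" "e' \<in> hedges H" "x \<in> e'" "y \<in> e'"
      using e by (auto simp: Gaif_def)
    moreover obtain t where "t \<in> gverts T" "e' \<subseteq> X t"
      using h \<open>e' \<in> hedges H\<close> by (auto simp: tree_decomposition_def)
    ultimately show ?thesis by blast
  qed
  then show ?G using h by (auto simp: tree_decomposition_def Gaif_def)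
qed

lemma tw_Gaif: "hypergraph H \<Longrightarrow> tw (Gaif H) = tw_Hyp H"
  by (simp add: tw_def tw_Hyp_def tree_decomposition_Gaif)

section \<open>Homomorphisms of hypergraphs\<close>

text \<open>Preserving every class of n-element hyperedges is preserving hyperedges together with
  their cardinality; on finite hyperedges this means injectivity on each of them.\<close>

lemma hyp_hom_iff:
  "f \<in> hyp_hom H H' \<longleftrightarrow> f \<in> hverts H \<rightarrow>\<^sub>E hverts H' \<and>
     (\<forall>e\<in>hedges H. f ` e \<in> hedges H' \<and> card (f ` e) = card e)"
  by (auto simp: hyp_hom_def hedges_card_def)

lemma hyp_hom_compose:
  assumes "f \<in> hyp_hom A B" "g \<in> hyp_hom B C" "hypergraph A"
  shows "compose (hverts A) g f \<in> hyp_hom A C"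
proof -
  have "compose (hverts A) g f ` e = g ` f ` e" if "e \<in> hedges A" for e
  proof -
    have "e \<subseteq> hverts A" using that assms(3) by (simp add: hypergraph_def)
    then show ?thesis by (auto simp: compose_def image_image subset_iff intro!: image_cong)
  qed
  moreover have "compose (hverts A) g f \<in> hverts A \<rightarrow>\<^sub>E hverts C"
    using assms(1,2) by (auto simp: hyp_hom_iff compose_def)
  ultimately show ?thesis
    using assms(1,2) by (simp add: hyp_hom_iff)
qed

text \<open>Cancellability is tested against the hypergraph with one vertex and no hyperedge.\<close>
lemma hyp_mono_iff:
  assumes "hypergraph X"
  shows "hyp_mono X Y f \<longleftrightarrow> f \<in> hyp_hom X Y \<and> inj_on f (hverts X)"
proof
  assume m: "hyp_mono X Y f"
  have "x = y" if xy: "x \<in> hverts X" "y \<in> hverts X" "f x = f y" for x y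
  proof -
    define Z :: "nat pre_hypergraph" where "Z = \<lparr>hverts = {0}, hedges = {}\<rparr>"
    have "hypergraph Z" by (simp add: Z_def hypergraph_def)
    moreover have "(\<lambda>z\<in>{0}. w) \<in> hyp_hom Z X" if "w \<in> hverts X" for w
      using that by (auto simp: Z_def hyp_hom_iff)
    moreover have "compose (hverts Z) f (\<lambda>z\<in>{0}. x) = compose (hverts Z) f (\<lambda>z\<in>{0}. y)"
      using xy by (auto simp: Z_def compose_def)
    ultimately have "(\<lambda>z\<in>{0::nat}. x) = (\<lambda>z\<in>{0}. y)"
      using m xy unfolding hyp_mono_def by blast
    then show ?thesis by (metis restrict_apply' singletonI)
  qed
  then show "f \<in> hyp_hom X Y \<and> inj_on f (hverts X)"
    using m by (auto simp: hyp_mono_def inj_on_def)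
next
  assume f: "f \<in> hyp_hom X Y \<and> inj_on f (hverts X)"
  have "g = h" if "g \<in> hyp_hom Z X" "h \<in> hyp_hom Z X"
    "compose (hverts Z) f g = compose (hverts Z) f h" for g h and Z :: "nat pre_hypergraph"
  proof (rule ext)
    fix z
    show "g z = h z"
    proof (cases "z \<in> hverts Z")
      case True
      then have "f (g z) = f (h z)" using that(3) by (metis compose_eq)
      then show ?thesis using that(1,2) f True by (auto simp: hyp_hom_iff dest: inj_onD)
    next
      case False
      then show ?thesis using that(1,2) by (auto simp: hyp_hom_iff PiE_def extensional_def)
    qed
  qed
  then show "hyp_mono X Y f" using f by (auto simp: hyp_mono_def)
qed

text \<open>Every nonempty set is a hyperedge of \<open>hyp_complete m\<close>, so an enumeration of
  the vertices is a monomorphism. Conversely, monomorphisms are injective and \<open>{1..m}\<close>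
  has \<open>m\<close> elements.\<close>

lemma hyp_size_eq_card:
  assumes X: "hypergraph X"
  shows "hyp_size X = card (hverts X)"
  unfolding hyp_size_def
proof (rule Least_equality)
  have fin: "finite (hverts X)" using X by (simp add: hypergraph_def)
  then obtain f where f: "bij_betw f (hverts X) {1..card (hverts X)}"
    using finite_same_card_bij[of "hverts X" "{1..card (hverts X)}"] by auto
  let ?g = "restrict f (hverts X)"
  have inj: "inj_on ?g (hverts X)" using f by (simp add: bij_betw_def)
  have "?g ` e \<in> hedges (hyp_complete (card (hverts X))) \<and> card (?g ` e) = card e"
    if "e \<in> hedges X" for e
  proof -
    have e: "e \<subseteq> hverts X" "e \<noteq> {}" using that X by (auto simp: hypergraph_def)
    then have "?g ` e \<subseteq> {1..card (hverts X)}" using f by (auto simp: bij_betw_def)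
    moreover have "card (?g ` e) = card e"
      using inj e by (intro card_image) (blast intro: inj_on_subset)
    moreover have "?g ` e \<noteq> {}" using e by blast
    ultimately show ?thesis unfolding hyp_complete_def by simp
  qed
  moreover have "?g \<in> hverts X \<rightarrow>\<^sub>E hverts (hyp_complete (card (hverts X)))"
    using f by (auto simp: hyp_complete_def bij_betw_def)
  ultimately have "hyp_mono X (hyp_complete (card (hverts X))) ?g"
    using inj by (simp add: hyp_mono_iff[OF X] hyp_hom_iff)
  then show "\<exists>m\<le>card (hverts X). \<exists>f. hyp_mono X (hyp_complete m) f" by blast
next
  fix n assume "\<exists>m\<le>n. \<exists>f. hyp_mono X (hyp_complete m) f"
  then obtain m f where m: "m \<le> n" "f \<in> hyp_hom X (hyp_complete m)" "inj_on f (hverts X)"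
    by (auto simp: hyp_mono_iff[OF X])
  then have "card (hverts X) \<le> card {1..m}"
    by (intro card_inj_on_le) (auto simp: hyp_hom_iff hyp_complete_def)
  then show "card (hverts X) \<le> n" using m by simp
qed

lemma hyp_id_apply [simp]: "x \<in> hverts H \<Longrightarrow> hyp_id H x = x"
  by (simp add: hyp_id_def)

lemma hyp_id_image: "e \<subseteq> hverts H \<Longrightarrow> hyp_id H ` e = e"
  by (force simp: hyp_id_def)

lemma hyp_id_inclusion:
  assumes "hypergraph H" "hverts H \<subseteq> hverts K" "hedges H \<subseteq> hedges K"
  shows "hyp_id H \<in> hyp_hom H K"
proof -
  have "hyp_id H ` e = e" if "e \<in> hedges H" for e
    using that assms(1) by (auto intro!: hyp_id_image simp: hypergraph_def)
  then show ?thesis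
    using assms by (auto simp: hyp_hom_iff hyp_id_def)
qed

text \<open>Transport of bags, used for isomorphisms and for renaming vertices to natural numbers.
  Injectivity makes images commute with intersections, which gives the path condition.\<close>

lemma tree_decomposition_iso:
  assumes td: "tree_decomposition (hverts L) (hedges L) T X"
    and f: "bij_betw f (hverts L) (hverts K)"
    and E: "\<And>e. e \<in> hedges K \<Longrightarrow> \<exists>e'\<in>hedges L. f ` e' = e"
  shows "tree_decomposition (hverts K) (hedges K) T (\<lambda>t. f ` X t)"
proof -
  have tT: "tree T" and pow: "\<And>t. t \<in> gverts T \<Longrightarrow> X t \<subseteq> hverts L"
    and cov: "(\<Union>t\<in>gverts T. X t) = hverts L"
    and ed: "\<And>e. e \<in> hedges L \<Longrightarrow> \<exists>t\<in>gverts T. e \<subseteq> X t"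
    and pth: "\<And>t1 t2 t3 p. path_between T t1 p t3 \<Longrightarrow> t2 \<in> set p \<Longrightarrow> X t1 \<inter> X t3 \<subseteq> X t2"
    using td by (auto simp: tree_decomposition_def) blast+
  have "f ` X t1 \<inter> f ` X t3 \<subseteq> f ` X t2" if p: "path_between T t1 p t3" "t2 \<in> set p" for t1 t2 t3 p
  proof -
    have "t1 \<in> gverts T" "t3 \<in> gverts T" using p by (auto simp: path_between_def walk_def)
    then have "f ` X t1 \<inter> f ` X t3 = f ` (X t1 \<inter> X t3)"
      using f pow by (metis bij_betw_def inj_on_image_Int)
    then show ?thesis using pth[OF p] by blast
  qed
  moreover have "(\<Union>t\<in>gverts T. f ` X t) = hverts K"
    using cov f by (metis bij_betw_def image_UN)
  moreover have "\<exists>t\<in>gverts T. e \<subseteq> f ` X t" if "e \<in> hedges K" for e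
    using E[OF that] ed by blast
  moreover have "(\<lambda>t. f ` X t) \<in> gverts T \<rightarrow> Pow (hverts K)"
    using pow f by (fastforce simp: bij_betw_def)
  ultimately show ?thesis using tT unfolding tree_decomposition_def by blast
qed

section \<open>From structured decompositions to tree decompositions\<close>

text \<open>Edges of \<open>T\<close> have endpoints, so cocone maps at edges factor through cocone
  maps at vertices.\<close>

lemma int_objects_arrow_Vertex:
  assumes "tree T" "i \<in> int_objects T"
  obtains t where "t \<in> gverts T" "int_arrow T i (Vertex t)"
proof (cases i)
  case (Vertex t)
  then show ?thesis using that assms(2) by (auto simp: int_objects_def int_arrow_def)
next
  case (Edge e)
  then have e: "e \<in> gedges T" using assms(2) by (auto simp: int_objects_def)
  then obtain x y where "e = {x, y}" using tree_edgeD(2)[OF assms(1)] by blast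
  then have "x \<in> gverts T" "int_arrow T i (Vertex x)"
    using e Edge tree_edgeD(1)[OF assms(1) e] by (auto simp: int_arrow_def)
  then show ?thesis using that by blast
qed

lemma cocone_compose:
  assumes "cocone T D M L c" "int_arrow T i j"
  shows "compose (hverts (D i)) (c j) (M i j) = c i"
  using assms by (simp add: cocone_def)

lemma cocone_apply:
  assumes "cocone T D M L c" "int_arrow T i j" "a \<in> hverts (D i)"
  shows "c j (M i j a) = c i a"
  using cocone_compose[OF assms(1,2)] assms(3) by (metis compose_eq)

lemma colimit_unique_morphism:
  assumes "colimit T D M L c" "cocone T D M L' c'"
    and "u \<in> hyp_hom L L'" "\<And>i. i \<in> int_objects T \<Longrightarrow> compose (hverts (D i)) u (c i) = c' i"
    and "v \<in> hyp_hom L L'" "\<And>i. i \<in> int_objects T \<Longrightarrow> compose (hverts (D i)) v (c i) = c' i"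
  shows "u = v"
  using assms unfolding colimit_def by blast

text \<open>The images of the cocone maps form a subhypergraph through which the cocone factors; the
  universal property forces it to be everything.\<close>
lemma colimit_jointly_surjective:
  assumes T: "tree T" and F: "hyp_functor T D M" and L: "colimit T D M L c"
  shows "hverts L = (\<Union>t\<in>gverts T. c (Vertex t) ` hverts (D (Vertex t)))"
    and "hedges L = (\<Union>t\<in>gverts T. (`) (c (Vertex t)) ` hedges (D (Vertex t)))"
proof -
  define L' where "L' = \<lparr>hverts = (\<Union>t\<in>gverts T. c (Vertex t) ` hverts (D (Vertex t))),
    hedges = (\<Union>t\<in>gverts T. (`) (c (Vertex t)) ` hedges (D (Vertex t)))\<rparr>"
  have co: "cocone T D M L c" using L by (simp add: colimit_def)
  have hL: "hypergraph L" using co by (simp add: cocone_def)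
  have D: "hypergraph (D i)" if "i \<in> int_objects T" for i
    using F that by (simp add: hyp_functor_def)
  have cV: "c (Vertex t) \<in> hyp_hom (D (Vertex t)) L" "hypergraph (D (Vertex t))"
    if "t \<in> gverts T" for t
    using co D that by (auto simp: cocone_def int_objects_def)
  have V: "hverts L' \<subseteq> hverts L"
    using cV by (fastforce simp: L'_def hyp_hom_iff)
  have E: "hedges L' \<subseteq> hedges L"
    using cV by (fastforce simp: L'_def hyp_hom_iff)
  have "e \<subseteq> hverts L'" if e: "e \<in> hedges L'" for e
  proof -
    obtain t e' where "t \<in> gverts T" "e' \<in> hedges (D (Vertex t))" "e = c (Vertex t) ` e'"
      using e by (auto simp: L'_def)
    moreover have "e' \<subseteq> hverts (D (Vertex t))"
      using cV calculation by (auto simp: hypergraph_def)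
    ultimately show ?thesis by (auto simp: L'_def)
  qed
  then have hL': "hypergraph L'"
    using hL V E by (auto simp: hypergraph_def intro: finite_subset)
  have cV': "c (Vertex t) \<in> hyp_hom (D (Vertex t)) L'" if "t \<in> gverts T" for t
    using cV(1)[OF that] that by (auto simp: L'_def hyp_hom_iff PiE_iff)
  \<comment> \<open>At an edge, \<open>c i\<close> is a map of the diagram followed by some
    \<open>c (Vertex t)\<close>, so it also lands in \<open>L'\<close>.\<close>
  have "c i \<in> hyp_hom (D i) L'" if i: "i \<in> int_objects T" for i
  proof -
    obtain t where t: "t \<in> gverts T" "int_arrow T i (Vertex t)"
      using int_objects_arrow_Vertex[OF T i] .
    then have "M i (Vertex t) \<in> hyp_hom (D i) (D (Vertex t))"
      using F by (simp add: hyp_functor_def)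
    then have "compose (hverts (D i)) (c (Vertex t)) (M i (Vertex t)) \<in> hyp_hom (D i) L'"
      using hyp_hom_compose cV' t D i by blast
    then show ?thesis using cocone_compose[OF co t(2)] by simp
  qed
  then have co': "cocone T D M L' c" using hL' co by (simp add: cocone_def)
  then obtain u where u: "u \<in> hyp_hom L L'"
    "\<And>i. i \<in> int_objects T \<Longrightarrow> compose (hverts (D i)) u (c i) = c i"
    using L unfolding colimit_def by blast
  \<comment> \<open>Followed by the inclusion of \<open>L'\<close>, \<open>u\<close> becomes an
    endomorphism of \<open>L\<close> compatible with \<open>c\<close>. So is the identity;
    uniqueness makes them equal, and the identity takes values in \<open>L'\<close>.\<close>
  have "u \<in> hyp_hom L L" using u(1) V E by (auto simp: hyp_hom_iff PiE_iff)
  moreover have "compose (hverts (D i)) (hyp_id L) (c i) = c i" if "i \<in> int_objects T" for i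
  proof -
    have "c i \<in> hverts (D i) \<rightarrow>\<^sub>E hverts L" using co that by (simp add: cocone_def hyp_hom_iff)
    then show ?thesis by (auto simp: compose_def fun_eq_iff PiE_iff extensional_def)
  qed
  ultimately have "u = hyp_id L"
    using colimit_unique_morphism[OF L co _ u(2) hyp_id_inclusion] hL by blast
  then have id: "hyp_id L \<in> hyp_hom L L'" using u(1) by simp
  then have "hverts L \<subseteq> hverts L'" by (force simp: hyp_hom_iff)
  moreover have "hedges L \<subseteq> hedges L'"
    using id hL by (fastforce simp: hyp_hom_iff hypergraph_def hyp_id_image)
  ultimately have "hverts L = hverts L'" "hedges L = hedges L'" using V E by auto
  then show "hverts L = (\<Union>t\<in>gverts T. c (Vertex t) ` hverts (D (Vertex t)))"
    "hedges L = (\<Union>t\<in>gverts T. (`) (c (Vertex t)) ` hedges (D (Vertex t)))"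
    by (auto simp: L'_def)
qed

text \<open>If \<open>v\<close> is missing from the bag at \<open>t2\<close>, it can be split into two vertices \<open>v\<close> and \<open>v'\<close>,
  where \<open>v'\<close> takes over the occurrences of \<open>v\<close> on the component of \<open>t1\<close> in \<open>T - t2\<close>. The
  resulting cocone does not factor through \<open>L\<close>.\<close>
lemma colimit_path_condition:
  assumes T: "tree T" and F: "hyp_functor T D M" and L: "colimit T D M L c"
    and p: "path_between T t1 p t3" "t2 \<in> set p"
  defines "X \<equiv> \<lambda>t. c (Vertex t) ` hverts (D (Vertex t))"
  shows "X t1 \<inter> X t3 \<subseteq> X t2"
proof (rule subsetI, rule ccontr)
  fix v assume v13: "v \<in> X t1 \<inter> X t3" and v2: "v \<notin> X t2"
  have co: "cocone T D M L c" using L by (simp add: colimit_def)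
  have hL: "hypergraph L" using co by (simp add: cocone_def)
  then have "finite (hverts L)" by (simp add: hypergraph_def)
  then obtain v' where v': "v' \<notin> hverts L" using ex_new_if_finite infinite_UNIV_nat by blast
  have t13: "t1 \<in> gverts T" "t3 \<in> gverts T"
    using p by (auto simp: path_between_def walk_def)
  define A where "A = {t. \<exists>q. walk T q \<and> hd q = t1 \<and> last q = t \<and> t2 \<notin> set q}"
  have "t1 \<noteq> t2" using v13 v2 by auto
  then have A1: "t1 \<in> A" using t13 unfolding A_def
    by (auto intro!: exI[of _ "[t1]"] simp: walk_Cons)
  have A3: "t3 \<notin> A" using tree_path_separates[OF T p] unfolding A_def by blast
  have A_step: "y \<in> A" if x: "x \<in> A" and e: "{x, y} \<in> gedges T" and y: "y \<noteq> t2" for x y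
  proof -
    obtain q where q: "walk T q" "hd q = t1" "last q = x" "t2 \<notin> set q"
      using x by (auto simp: A_def)
    have "q \<noteq> []" using q by auto
    moreover have "y \<in> gverts T" using tree_edgeD(1)[OF T e] by blast
    ultimately have "walk T (q @ [y])" "hd (q @ [y]) = t1" "t2 \<notin> set (q @ [y])"
      using q e y by (auto simp: walk_append walk_Cons)
    then show ?thesis unfolding A_def by (metis (mono_tags, lifting) last_snoc mem_Collect_eq)
  qed
  \<comment> \<open>An edge counts as lying on the side of \<open>t1\<close> as soon as one endpoint
    does, so the edges from \<open>A\<close> to \<open>t2\<close> belong to that side.\<close>
  define side where "side i = (case i of Vertex t \<Rightarrow> t \<in> A | Edge e \<Rightarrow> e \<inter> A \<noteq> {})" for i
  define g where "g b = (\<lambda>w\<in>hverts L. if b \<and> w = v then v' else w)" for b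
  \<comment> \<open>All nonempty sets are hyperedges, so injectivity alone makes \<open>g b\<close>
    a homomorphism.\<close>
  define K where "K = \<lparr>hverts = insert v' (hverts L),
    hedges = {e. e \<noteq> {} \<and> e \<subseteq> insert v' (hverts L)}\<rparr>"
  define c' where "c' i = compose (hverts (D i)) (g (side i)) (c i)" for i
  have hK: "hypergraph K" using hL by (auto simp: K_def hypergraph_def)
  have g: "g b \<in> hyp_hom L K" for b
  proof -
    have inj: "inj_on (g b) (hverts L)" using v' by (auto simp: g_def inj_on_def)
    have PiE: "g b \<in> hverts L \<rightarrow>\<^sub>E hverts K" by (auto simp: g_def K_def)
    have "g b ` e \<in> hedges K \<and> card (g b ` e) = card e" if "e \<in> hedges L" for e
    proof -
      have e: "e \<noteq> {}" "e \<subseteq> hverts L" using that hL by (auto simp: hypergraph_def)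
      then have "g b ` e \<subseteq> hverts K" using PiE by blast
      moreover have "card (g b ` e) = card e"
        using inj e by (intro card_image) (blast intro: inj_on_subset)
      ultimately show ?thesis using e by (simp add: K_def)
    qed
    then show ?thesis using PiE by (simp add: hyp_hom_iff)
  qed
  have c'_hom: "c' i \<in> hyp_hom (D i) K" if "i \<in> int_objects T" for i
    unfolding c'_def using that co F g
    by (intro hyp_hom_compose) (auto simp: cocone_def hyp_functor_def)
  have glue: "g (side j) (c i a) = g (side i) (c i a)"
    if ij: "int_arrow T i j" and a: "a \<in> hverts (D i)" for i j a
  proof (cases "i = j")
    case False
    then obtain e x where e: "e \<in> gedges T" "x \<in> e" "i = Edge e" "j = Vertex x"
      using ij by (auto simp: int_arrow_def)
    obtain y where y: "e = {x, y}" using tree_edgeD(2)[OF T e(1)] e(2) by blast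
    show ?thesis
    \<comment> \<open>The sides of an edge and its endpoint \<open>x\<close> differ only when the
      edge leaves \<open>A\<close> at \<open>x\<close>. Then \<open>x = t2\<close>, where
      \<open>v\<close> does not occur, and the two maps \<open>g\<close> agree away from
      \<open>v\<close>.\<close>
    proof (cases "x \<notin> A \<and> y \<in> A")
      case True
      then have "x = t2" using A_step[of y x] e y by (auto simp: insert_commute)
      have "M i j \<in> hyp_hom (D i) (D j)" using F ij by (simp add: hyp_functor_def)
      then have "M i j a \<in> hverts (D j)" using a by (auto simp: hyp_hom_iff)
      then have "c j (M i j a) \<in> X t2" using e \<open>x = t2\<close> by (auto simp: X_def)
      then have "c i a \<noteq> v" using v2 cocone_apply[OF co ij a] by auto
      then show ?thesis by (simp add: g_def)
    next
      case False
      then have "side i = side j" using e y by (auto simp: side_def)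
      then show ?thesis by simp
    qed
  qed simp
  have "compose (hverts (D i)) (c' j) (M i j) = c' i" if ij: "int_arrow T i j" for i j
  proof (rule ext)
    fix a
    show "compose (hverts (D i)) (c' j) (M i j) a = c' i a"
    proof (cases "a \<in> hverts (D i)")
      case True
      have "M i j \<in> hyp_hom (D i) (D j)" using F ij by (simp add: hyp_functor_def)
      then have "M i j a \<in> hverts (D j)" using True by (auto simp: hyp_hom_iff)
      then show ?thesis
        using True glue[OF ij True] cocone_apply[OF co ij True] by (simp add: c'_def compose_eq)
    qed (simp add: c'_def compose_def)
  qed
  then have "cocone T D M K c'" using hK c'_hom by (simp add: cocone_def)
  then obtain u where u: "\<And>i. i \<in> int_objects T \<Longrightarrow> compose (hverts (D i)) u (c i) = c' i"
    using L unfolding colimit_def by blast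
  have uv: "u v = g (t \<in> A) v" if t: "t \<in> gverts T" "v \<in> X t" for t
  proof -
    obtain a where a: "a \<in> hverts (D (Vertex t))" "v = c (Vertex t) a"
      using t by (auto simp: X_def)
    have "compose (hverts (D (Vertex t))) u (c (Vertex t)) = c' (Vertex t)"
      using u that by (simp add: int_objects_def)
    from fun_cong[OF this, of a] show ?thesis using a by (simp add: c'_def compose_eq side_def)
  qed
  \<comment> \<open>The bags at \<open>t1\<close> and \<open>t3\<close> prescribe the values
    \<open>v'\<close> and \<open>v\<close> for the same \<open>u v\<close>. Evaluating
    \<open>g\<close> at \<open>v\<close> requires \<open>v\<close> to be a vertex of
    \<open>L\<close>, since \<open>g\<close> is restricted to \<open>hverts L\<close>.\<close>
  have "g True v = g False v" using uv[of t1] uv[of t3] t13 v13 A1 A3 by simp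
  moreover have "v \<in> hverts L"
    using colimit_jointly_surjective(1)[OF T F L] t13 v13 by (auto simp: X_def)
  ultimately show False using v' by (auto simp: g_def)
qed

lemma colimit_tree_decomposition:
  assumes T: "tree T" and F: "hyp_functor T D M" and L: "colimit T D M L c"
  shows "tree_decomposition (hverts L) (hedges L) T
    (\<lambda>t. c (Vertex t) ` hverts (D (Vertex t)))"
proof -
  have "e \<subseteq> hverts (D (Vertex t))" if "t \<in> gverts T" "e \<in> hedges (D (Vertex t))" for t e
    using F that by (auto simp: hyp_functor_def int_objects_def hypergraph_def)
  then have "\<forall>e\<in>hedges L. \<exists>t\<in>gverts T. e \<subseteq> c (Vertex t) ` hverts (D (Vertex t))"
    unfolding colimit_jointly_surjective(2)[OF assms] by (fastforce intro: image_mono)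
  then show ?thesis
    using T colimit_path_condition[OF assms]
    unfolding tree_decomposition_def colimit_jointly_surjective(1)[OF assms] by blast
qed

section \<open>Passing from the colimit to \<open>H\<close>, and the width bound\<close>

lemma hyp_iso_bij_betw:
  assumes iso: "hyp_iso L H" and L: "hypergraph L" and H: "hypergraph H"
  obtains f where "bij_betw f (hverts L) (hverts H)"
    "\<And>e. e \<in> hedges H \<Longrightarrow> \<exists>e'\<in>hedges L. f ` e' = e"
proof -
  obtain f g where f: "f \<in> hyp_hom L H" and g: "g \<in> hyp_hom H L"
    and "compose (hverts L) g f = hyp_id L" "compose (hverts H) f g = hyp_id H"
    using iso by (auto simp: hyp_iso_def)
  then have gf: "g (f x) = x" if "x \<in> hverts L" for x
    using that by (metis compose_eq hyp_id_apply)
  have fg: "f (g y) = y" if "y \<in> hverts H" for y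
    using that \<open>compose (hverts H) f g = hyp_id H\<close> by (metis compose_eq hyp_id_apply)
  have "bij_betw f (hverts L) (hverts H)"
    using f g gf fg by (intro bij_betw_byWitness[where f' = g]) (auto simp: hyp_hom_iff)
  moreover have "\<exists>e'\<in>hedges L. f ` e' = e" if e: "e \<in> hedges H" for e
  proof
    show "g ` e \<in> hedges L" using g e by (simp add: hyp_hom_iff)
    have "e \<subseteq> hverts H" using e H by (simp add: hypergraph_def)
    then show "f ` g ` e = e" using fg by (force simp: image_image)
  qed
  ultimately show ?thesis using that by blast
qed

lemma tree_finite_nonempty: "tree T \<Longrightarrow> finite (gverts T)" "tree T \<Longrightarrow> gverts T \<noteq> {}"
  by (auto simp: tree_def simple_graph_def)

lemma structured_decomposition_imp_tree_decomposition:
  assumes sd: "structured_decomposition H T D M" and H: "hypergraph H"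
  shows "\<exists>X. tree_decomposition (hverts H) (hedges H) T X \<and> td_width T X \<le> sd_width T D"
proof -
  have T: "tree T" and F: "hyp_functor T D M"
    using sd by (auto simp: structured_decomposition_def)
  obtain L c where L: "colimit T D M L c" and iso: "hyp_iso L H"
    using sd by (auto simp: structured_decomposition_def)
  have hL: "hypergraph L" using L by (simp add: colimit_def cocone_def)
  obtain f where f: "bij_betw f (hverts L) (hverts H)"
    "\<And>e. e \<in> hedges H \<Longrightarrow> \<exists>e'\<in>hedges L. f ` e' = e"
    using hyp_iso_bij_betw[OF iso hL H] by blast
  define X where "X t = f ` c (Vertex t) ` hverts (D (Vertex t))" for t
  have "tree_decomposition (hverts H) (hedges H) T X"
    unfolding X_def
    by (rule tree_decomposition_iso[OF colimit_tree_decomposition[OF T F L] f])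
  moreover have "td_width T X \<le> sd_width T D"
  proof -
    \<comment> \<open>Taking images can only lose vertices, and the size of a hypergraph counts its
      vertices.\<close>
    have "card (X t) \<le> hyp_size (D (Vertex t))" if "t \<in> gverts T" for t
    proof -
      have D: "hypergraph (D (Vertex t))" using F that by (auto simp: hyp_functor_def int_objects_def)
      then have "finite (hverts (D (Vertex t)))" by (simp add: hypergraph_def)
      then have "card (X t) \<le> card (hverts (D (Vertex t)))"
        unfolding X_def image_image by (rule card_image_le)
      then show ?thesis using hyp_size_eq_card[OF D] by simp
    qed
    then have "(MAX t\<in>gverts T. int (card (X t))) \<le> (MAX t\<in>gverts T. int (hyp_size (D (Vertex t))))"
      using tree_finite_nonempty[OF T]
      by (intro Max.boundedI) (auto intro!: Max.coboundedI[THEN order_trans[rotated]])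
    then show ?thesis by (simp add: td_width_def sd_width_def)
  qed
  ultimately show ?thesis by blast
qed

section \<open>From tree decompositions to structured decompositions\<close>

definition induced :: "'a pre_hypergraph \<Rightarrow> 'a set \<Rightarrow> 'a pre_hypergraph" where
  "induced K S = \<lparr>hverts = S, hedges = {e \<in> hedges K. e \<subseteq> S}\<rparr>"

text \<open>The intersection at an edge is the overlap along which the two neighbouring bags are
  glued.\<close>

definition bag :: "('t \<Rightarrow> 'a set) \<Rightarrow> 't int_object \<Rightarrow> 'a set" where
  "bag X i = (case i of Vertex t \<Rightarrow> X t | Edge e \<Rightarrow> \<Inter> (X ` e))"

lemma induced_simps [simp]:
  "hverts (induced K S) = S" "hedges (induced K S) = {e \<in> hedges K. e \<subseteq> S}"
  by (simp_all add: induced_def)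

lemma bag_simps [simp]: "bag X (Vertex t) = X t" "bag X (Edge e) = \<Inter> (X ` e)"
  by (simp_all add: bag_def)

lemma hypergraph_induced:
  "hypergraph K \<Longrightarrow> S \<subseteq> hverts K \<Longrightarrow> hypergraph (induced K S)"
  by (auto simp: hypergraph_def intro: finite_subset)

lemma bag_mono: "int_arrow T i j \<Longrightarrow> bag X i \<subseteq> bag X j"
  by (auto simp: int_arrow_def)

text \<open>All maps are inclusions; an extensional function does not record its codomain, so each
  of them is \<open>hyp_id (D i)\<close>. The path condition makes the maps of any cocone agree
  wherever bags overlap, so they glue to a map on \<open>K\<close>; hyperedges are preserved because
  each lies in one bag.\<close>

lemma tree_decomposition_imp_structured_decomposition_nat:
  fixes K :: "nat pre_hypergraph"
  assumes K: "hypergraph K" and td: "tree_decomposition (hverts K) (hedges K) T X"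
  defines "D \<equiv> \<lambda>i. induced K (bag X i)"
  defines "M \<equiv> \<lambda>i j. hyp_id (D i)"
  shows "hyp_functor T D M"
    and "\<And>i j. int_arrow T i j \<Longrightarrow> hyp_mono (D i) (D j) (M i j)"
    and "colimit T D M K (\<lambda>i. hyp_id (D i))"
proof -
  have T: "tree T" and pow: "\<And>t. t \<in> gverts T \<Longrightarrow> X t \<subseteq> hverts K"
    and cov: "(\<Union>t\<in>gverts T. X t) = hverts K"
    and ed: "\<And>e. e \<in> hedges K \<Longrightarrow> \<exists>t\<in>gverts T. e \<subseteq> X t"
    and pth: "\<And>t1 t2 t3 p. path_between T t1 p t3 \<Longrightarrow> t2 \<in> set p \<Longrightarrow> X t1 \<inter> X t3 \<subseteq> X t2"
    using td by (auto simp: tree_decomposition_def) blast+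
  have bagK: "bag X i \<subseteq> hverts K" if i: "i \<in> int_objects T" for i
  proof -
    obtain t where "t \<in> gverts T" "int_arrow T i (Vertex t)"
      using int_objects_arrow_Vertex[OF T i] .
    then show ?thesis using bag_mono[of T i "Vertex t" X] pow by auto
  qed
  then have hD: "hypergraph (D i)" if "i \<in> int_objects T" for i
    using that K by (simp add: D_def hypergraph_induced)
  have arrow_dom: "i \<in> int_objects T" if "int_arrow T i j" for i j
    using that by (auto simp: int_arrow_def int_objects_def)
  have hom: "M i j \<in> hyp_hom (D i) (D j)" if ij: "int_arrow T i j" for i j
    unfolding M_def using hD[OF arrow_dom[OF ij]] bag_mono[OF ij, of X]
    by (intro hyp_id_inclusion) (auto simp: D_def)
  \<comment> \<open>Composing with an inclusion is restricting, which turns the functor and cocone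
    laws into set inclusions.\<close>
  have comp_id: "compose (hverts (D i)) h (hyp_id (D i)) = restrict h (hverts (D i))"
    for h :: "nat \<Rightarrow> nat" and i
    by (auto simp: compose_def hyp_id_def)
  have "M i k = compose (hverts (D i)) (M j k) (M i j)"
    if ij: "int_arrow T i j" and "int_arrow T j k" for i j k
    using bag_mono[OF ij, of X] unfolding M_def comp_id
    by (auto simp: D_def hyp_id_def fun_eq_iff)
  moreover have "M i i = hyp_id (D i)" for i by (simp add: M_def)
  ultimately show "hyp_functor T D M"
    using hD hom unfolding hyp_functor_def by blast
  show "hyp_mono (D i) (D j) (M i j)" if ij: "int_arrow T i j" for i j
    using hom[OF ij] hD[OF arrow_dom[OF ij]]
    by (simp add: hyp_mono_iff) (simp add: M_def hyp_id_def inj_on_def)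
  show "colimit T D M K (\<lambda>i. hyp_id (D i))"
    unfolding colimit_def
  proof (intro conjI allI impI)
    have "hyp_id (D i) \<in> hyp_hom (D i) K" if "i \<in> int_objects T" for i
      using hD bagK that by (intro hyp_id_inclusion) (auto simp: D_def)
    moreover have "compose (hverts (D i)) (hyp_id (D j)) (M i j) = hyp_id (D i)"
      if ij: "int_arrow T i j" for i j
      using bag_mono[OF ij, of X] unfolding M_def comp_id
      by (auto simp: D_def hyp_id_def fun_eq_iff)
    ultimately show "cocone T D M K (\<lambda>i. hyp_id (D i))" using K by (simp add: cocone_def)
  next
    fix L' c' assume co: "cocone T D M L' c'"
    have step: "c' i v = c' j v" if "int_arrow T i j" "v \<in> bag X i" for i j v
      using cocone_apply[OF co that(1), of v] that(2) by (simp add: M_def D_def)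
    \<comment> \<open>If \<open>v\<close> lies in every bag along a walk, it lies in every overlap,
      and each edge passes the value at \<open>v\<close> from one endpoint to the next.\<close>
    have walk_eq: "c' (Vertex (hd p)) v = c' (Vertex (last p)) v"
      if "walk T p" "\<forall>s\<in>set p. v \<in> X s" for p v
      using that
    proof (induction p)
      case (Cons x p)
      show ?case
      proof (cases "p = []")
        case False
        then have e: "{x, hd p} \<in> gedges T" and IH: "c' (Vertex (hd p)) v = c' (Vertex (last p)) v"
          using Cons by (auto simp: walk_Cons)
        have "v \<in> bag X (Edge {x, hd p})" using Cons.prems False by auto
        then have "c' (Edge {x, hd p}) v = c' (Vertex x) v"
          "c' (Edge {x, hd p}) v = c' (Vertex (hd p)) v"
          using e by (auto intro!: step simp: int_arrow_def)
        then show ?thesis using IH False by simp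
      qed simp
    qed simp
    have well_def: "c' (Vertex t) v = c' (Vertex t') v"
      if t: "t \<in> gverts T" "t' \<in> gverts T" "v \<in> X t" "v \<in> X t'" for t t' v
    proof -
      obtain p where p: "path_between T t p t'" using tree_path_exists[OF T t(1,2)] .
      then show ?thesis using walk_eq[of p v] pth[OF p] t by (auto simp: path_between_def)
    qed
    \<comment> \<open>Any bag containing \<open>v\<close> may supply the value;
      \<open>well_def\<close> makes the choice immaterial.\<close>
    define u where "u = (\<lambda>v\<in>hverts K. c' (Vertex (SOME t. t \<in> gverts T \<and> v \<in> X t)) v)"
    have u_eq: "u v = c' (Vertex t) v" if t: "t \<in> gverts T" "v \<in> X t" for t v
    proof -
      have "(SOME t. t \<in> gverts T \<and> v \<in> X t) \<in> gverts T \<and> v \<in> X (SOME t. t \<in> gverts T \<and> v \<in> X t)"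
        using someI[of "\<lambda>t. t \<in> gverts T \<and> v \<in> X t" t] t by simp
      moreover have "v \<in> hverts K" using pow t by blast
      ultimately show ?thesis
        using well_def[of "SOME t. t \<in> gverts T \<and> v \<in> X t" t v] t by (simp add: u_def)
    qed
    have c'V: "c' (Vertex t) \<in> hyp_hom (D (Vertex t)) L'" if "t \<in> gverts T" for t
      using co that by (simp add: cocone_def int_objects_def)
    have c'_ext: "c' i \<in> extensional (bag X i)" if "i \<in> int_objects T" for i
      using co that by (simp add: cocone_def hyp_hom_iff D_def PiE_def)
    have u_img: "u ` e = c' (Vertex t) ` e" if "t \<in> gverts T" "e \<subseteq> X t" for t e
      using u_eq that by (intro image_cong) auto
    have "u v \<in> hverts L'" if v: "v \<in> hverts K" for v
    proof -
      obtain t where "t \<in> gverts T" "v \<in> X t" using v cov by blast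
      then show ?thesis using u_eq c'V[of t] by (auto simp: hyp_hom_iff D_def)
    qed
    then have uPi: "u \<in> hverts K \<rightarrow>\<^sub>E hverts L'" by (auto simp: u_def)
    have uhom: "u \<in> hyp_hom K L'"
      unfolding hyp_hom_iff
    proof (intro conjI ballI)
      fix e assume e: "e \<in> hedges K"
      then obtain t where t: "t \<in> gverts T" "e \<subseteq> X t" using ed by blast
      then show "u ` e \<in> hedges L'" "card (u ` e) = card e"
        using c'V[of t] u_img[OF t] e by (auto simp: hyp_hom_iff D_def)
    qed (fact uPi)
    have comp: "compose (hverts (D i)) u (hyp_id (D i)) = c' i" if i: "i \<in> int_objects T" for i
    proof -
      obtain t where t: "t \<in> gverts T" "int_arrow T i (Vertex t)"
        using int_objects_arrow_Vertex[OF T i] .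
      have "u v = c' i v" if "v \<in> bag X i" for v
        using u_eq[OF t(1), of v] step[OF t(2) that] bag_mono[OF t(2), of X] that by auto
      then show ?thesis using c'_ext[OF i] unfolding comp_id
        by (auto simp: D_def fun_eq_iff extensional_def)
    qed
    show "\<exists>!u. u \<in> hyp_hom K L' \<and>
        (\<forall>i\<in>int_objects T. compose (hverts (D i)) u (hyp_id (D i)) = c' i)"
    proof (rule ex1I[of _ u])
      show "u \<in> hyp_hom K L' \<and>
        (\<forall>i\<in>int_objects T. compose (hverts (D i)) u (hyp_id (D i)) = c' i)"
        using uhom comp by blast
    next
      fix w assume w: "w \<in> hyp_hom K L' \<and>
        (\<forall>i\<in>int_objects T. compose (hverts (D i)) w (hyp_id (D i)) = c' i)"
      show "w = u"
      proof (rule extensionalityI[of _ "hverts K"])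
        fix v assume "v \<in> hverts K"
        then obtain t where t: "t \<in> gverts T" "v \<in> X t" using cov by blast
        \<comment> \<open>A competing map is prescribed on each bag, and the bags cover
          \<open>K\<close>.\<close>
        then have "restrict w (hverts (D (Vertex t))) = c' (Vertex t)"
          using w by (simp add: comp_id int_objects_def)
        from fun_cong[OF this, of v] show "w v = u v" using t u_eq[OF t] by (simp add: D_def)
      qed (use w uPi in \<open>auto simp: hyp_hom_iff PiE_def\<close>)
    qed
  qed
qed

text \<open>Diagrams take values over \<open>nat\<close>, so \<open>H\<close> is first replaced by a
  copy \<open>K\<close> on natural numbers. The renaming is injective, so bags keep their
  cardinality and the width is unchanged.\<close>

lemma tree_decomposition_imp_structured_decomposition:
  assumes H: "hypergraph H" and td: "tree_decomposition (hverts H) (hedges H) T X"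
  shows "\<exists>D M. structured_decomposition H T D M \<and> sd_width T D = td_width T X"
proof -
  have fin: "finite (hverts H)" using H by (simp add: hypergraph_def)
  then obtain f :: "_ \<Rightarrow> nat" where f: "inj_on f (hverts H)"
    using finite_imp_inj_to_nat_seg by metis
  define K where "K = \<lparr>hverts = f ` hverts H, hedges = (`) f ` hedges H\<rparr>"
  have K: "hypergraph K" using H fin by (auto simp: K_def hypergraph_def)
  define Y where "Y t = f ` X t" for t
  have Y: "tree_decomposition (hverts K) (hedges K) T Y"
    unfolding Y_def by (rule tree_decomposition_iso[OF td]) (use f in \<open>auto simp: K_def bij_betw_def\<close>)
  define D where "D i = induced K (bag Y i)" for i
  let ?M = "\<lambda>i j. hyp_id (D i)"
  note sd = tree_decomposition_imp_structured_decomposition_nat[OF K Y, folded D_def]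
  have T: "tree T" using td by (simp add: tree_decomposition_def)
  \<comment> \<open>Homomorphisms are extensional, so both mutually inverse renamings are restricted
    to their domains.\<close>
  define g where "g = (\<lambda>y\<in>hverts K. inv_into (hverts H) f y)"
  define f' where "f' = restrict f (hverts H)"
  have gf: "g (f x) = x" if "x \<in> hverts H" for x
    using that f by (simp add: g_def K_def)
  have eH: "e \<subseteq> hverts H" if "e \<in> hedges H" for e
    using that H by (simp add: hypergraph_def)
  have "hyp_iso K H"
    unfolding hyp_iso_def
  proof (intro bexI conjI)
    have img: "g ` f ` e = e" "card (f ` e) = card e" if "e \<in> hedges H" for e
      using eH[OF that] gf f by (force simp: image_image, meson card_image inj_on_subset)
    have f'_img: "f' ` e = f ` e" if "e \<in> hedges H" for e
      using eH[OF that] by (auto simp: f'_def)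
    show "g \<in> hyp_hom K H"
      using img gf by (auto simp: hyp_hom_iff K_def) (auto simp: g_def K_def)
    show "f' \<in> hyp_hom H K"
      using img f'_img by (auto simp: hyp_hom_iff K_def) (auto simp: f'_def)
    show "compose (hverts K) f' g = hyp_id K"
      using gf by (auto simp: compose_def hyp_id_def K_def f'_def fun_eq_iff)
    show "compose (hverts H) g f' = hyp_id H"
      using gf by (auto simp: compose_def hyp_id_def f'_def)
  qed
  then have "structured_decomposition H T D ?M"
    unfolding structured_decomposition_def using T sd by blast
  moreover have "sd_width T D = td_width T X"
  proof -
    have "hyp_size (D (Vertex t)) = card (X t)" if t: "t \<in> gverts T" for t
    proof -
      have "X t \<subseteq> hverts H" using td t by (auto simp: tree_decomposition_def)
      then have "card (Y t) = card (X t)"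
        using f unfolding Y_def by (intro card_image) (rule inj_on_subset)
      moreover have "hypergraph (D (Vertex t))"
        using sd(1) t by (simp add: hyp_functor_def int_objects_def)
      ultimately show ?thesis by (simp add: hyp_size_eq_card D_def)
    qed
    then show ?thesis by (simp add: sd_width_def td_width_def cong: image_cong_simp)
  qed
  ultimately show ?thesis by blast
qed

section \<open>Comparison of the minimum widths\<close>

text \<open>A set of integers may lack a least element, so the proof shows that the same
  \<open>k\<close> are least for \<open>P\<close> and for \<open>Q\<close>; the two
  \<open>LEAST\<close> terms then coincide in every case.\<close>

lemma Least_eq_if_dominated:
  fixes P Q :: "int \<Rightarrow> bool"
  assumes "\<And>k. Q k \<Longrightarrow> P k" and "\<And>k. P k \<Longrightarrow> \<exists>l\<le>k. Q l"
  shows "Least P = Least Q"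
proof -
  have "(P k \<and> (\<forall>l. P l \<longrightarrow> k \<le> l)) \<longleftrightarrow> (Q k \<and> (\<forall>l. Q l \<longrightarrow> k \<le> l))" for k
  proof
    assume k: "P k \<and> (\<forall>l. P l \<longrightarrow> k \<le> l)"
    then obtain l where l: "l \<le> k" "Q l" using assms(2)[of k] by auto
    then have "l = k" using k assms(1)[of l] by auto
    then show "Q k \<and> (\<forall>l. Q l \<longrightarrow> k \<le> l)" using l k assms(1) by simp
  next
    assume k: "Q k \<and> (\<forall>l. Q l \<longrightarrow> k \<le> l)"
    have "k \<le> l" if "P l" for l
      using assms(2)[OF that] k by fastforce
    then show "P k \<and> (\<forall>l. P l \<longrightarrow> k \<le> l)" using k assms(1) by simp
  qed
  then show ?thesis by (simp add: Least_def)
qed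

text \<open>Widths of tree decompositions are attained by structured decompositions, and widths of
  structured decompositions are bounded below by widths of tree decompositions. Both translations
  keep the tree.\<close>

lemma w_Hyp_eq_tw_Hyp:
  assumes H: "hypergraph H"
  shows "w_Hyp H = tw_Hyp H"
  unfolding w_Hyp_def tw_Hyp_def
proof (rule Least_eq_if_dominated)
  fix k assume "\<exists>(T :: nat pre_graph) X. tree_decomposition (hverts H) (hedges H) T X \<and> td_width T X = k"
  then show "\<exists>(T :: nat pre_graph) D M. structured_decomposition H T D M \<and> sd_width T D = k"
    using tree_decomposition_imp_structured_decomposition[OF H] by metis
next
  fix k assume "\<exists>(T :: nat pre_graph) D M. structured_decomposition H T D M \<and> sd_width T D = k"
  then show "\<exists>l\<le>k. \<exists>(T :: nat pre_graph) X.
      tree_decomposition (hverts H) (hedges H) T X \<and> td_width T X = l"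
    using structured_decomposition_imp_tree_decomposition[OF _ H] by metis
qed

theorem corollary3p5p11:
  fixes H :: "'a pre_hypergraph"
  assumes "hypergraph H"
  shows "w_Hyp H = tw (Gaif H) \<and> tw (Gaif H) = tw_Hyp H"
  using w_Hyp_eq_tw_Hyp[OF assms] tw_Gaif[OF assms] by simp

end
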